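(* Let $n\ge2$ and let $G=(V,E)$ be a loopless complete bipartite graph with $V=\{1,\dots,n\}$. Then $\mathcal P(\mathcal S^n_{r+})$ is closed for all $0\le r\le n$.
   Context: $\mathcal S^n$ is the space of real symmetric $n\times n$ matrices and $\mathcal S^n_{r+}\subseteq\mathcal S^n$ is the set of positive semidefinite matrices of rank at most $r$. The graph $G=(V,E)$ has index set $E\subseteq\{ij: 1\le i\le j\le n\}$; loopless means $ii\notin E$ for all $i$. $\mathcal P:\mathcal S^n\to\mathbb R^E$ is the coordinate projection $\mathcal P(X)=(X_{ij})_{ij\in E}$, and $\mathcal P(\mathcal S^n_{r+})$ is the image of $\mathcal S^n_{r+}$; closedness is in the Euclidean space $\mathbb R^E$. $G$ is complete bipartite if $V$ is the disjoint union of two nonempty sets such that the edges are exactly the pairs with one vertex in each set. *)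

theory Defs
  imports "HOL-Analysis.Analysis"
begin

text \<open>The vertex set \<open>{1,...,n}\<close> is the universe of a finite linearly ordered type
  \<open>'n\<close> with \<open>CARD('n) = n\<close>. The unordered pair \<open>ij\<close> is encoded by the
  ordered pair \<open>(i, j)\<close> with \<open>i \<le> j\<close>; loops are allowed here.\<close>

definition edge_set :: "('n::linorder \<times> 'n) set \<Rightarrow> bool" where
  "edge_set E \<longleftrightarrow> E \<subseteq> {(i, j). i \<le> j}"

definition loopless :: "('n \<times> 'n) set \<Rightarrow> bool" where
  "loopless E \<longleftrightarrow> (\<forall>i. (i, i) \<notin> E)"

definition adjacent :: "('n \<times> 'n) set \<Rightarrow> 'n \<Rightarrow> 'n \<Rightarrow> bool" where
  "adjacent E i j \<longleftrightarrow> (i, j) \<in> E \<or> (j, i) \<in> E"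

definition complete_bipartite :: "('n \<times> 'n) set \<Rightarrow> bool" where
  "complete_bipartite E \<longleftrightarrow>
     (\<exists>A B. A \<noteq> {} \<and> B \<noteq> {} \<and> A \<inter> B = {} \<and> A \<union> B = UNIV \<and>
        (\<forall>i j. adjacent E i j \<longleftrightarrow> (i \<in> A \<and> j \<in> B) \<or> (i \<in> B \<and> j \<in> A)))"

definition symmetric_matrix :: "real ^ 'n ^ 'n \<Rightarrow> bool" where
  "symmetric_matrix X \<longleftrightarrow> transpose X = X"

definition pos_semidef :: "real ^ 'n ^ 'n \<Rightarrow> bool" where
  "pos_semidef X \<longleftrightarrow> symmetric_matrix X \<and> (\<forall>v. 0 \<le> v \<bullet> (X *v v))"

definition psd_rank_le :: "nat \<Rightarrow> (real ^ 'n ^ 'n) set" where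
  "psd_rank_le r = {X. pos_semidef X \<and> rank X \<le> r}"

text \<open>A point of \<open>\<real>\<^sup>E\<close> is an extensional function on \<open>E\<close>. As \<open>E\<close> is
  finite, the Euclidean topology of \<open>\<real>\<^sup>E\<close> is the product topology
  \<open>powertop_real E\<close>, whose underlying set is \<open>E \<rightarrow>\<^sub>E UNIV\<close>.\<close>

definition coord_proj :: "('n \<times> 'n) set \<Rightarrow> real ^ 'n ^ 'n \<Rightarrow> ('n \<times> 'n \<Rightarrow> real)" where
  "coord_proj E X = (\<lambda>(i, j)\<in>E. X $ i $ j)"

end

(* For a complete bipartite graph with parts A and B, the projection only sees the A \<times> B block of the
   matrix, and the block of a matrix of rank at most r again has rank at most r. Conversely, if M has
   rank at most r and the r columns of W are an orthonormal basis of the column space of M, padded with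
   zeros, then M = W W^T M, so the Gram matrix of the rows of W (for A) and of M^T W (for B) is a
   completion of M of rank at most r. The projection is therefore the preimage of the matrices of rank
   at most r under a linear map, and these form a closed set because W ranges over a compact box. *)

theory Submission
  imports Defs
begin

text \<open>A compact box that contains every matrix whose columns indexed by \<open>S\<close> are
  unit vectors or zero and whose other columns vanish. Being an interval, it gets compactness
  directly; orthonormality of the columns is not imposed.\<close>

definition frame_box :: "'k set \<Rightarrow> (real ^ 'k ^ 'm) set" where
  "frame_box S = {(\<chi> i k. if k \<in> S then -1 else 0) .. (\<chi> i k. if k \<in> S then 1 else 0)}"

lemma mem_frame_box:
  "W \<in> frame_box S \<longleftrightarrow> (\<forall>i k. if k \<in> S then \<bar>W $ i $ k\<bar> \<le> 1 else W $ i $ k = 0)"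
  unfolding frame_box_def atLeastAtMost_iff less_eq_vec_def
  by (auto split: if_splits simp: abs_le_iff) (smt (verit))+

lemma compact_frame_box: "compact (frame_box S)"
  unfolding frame_box_def by (metis interval_cbox compact_cbox)

lemma rank_le_card_columns:
  fixes Z :: "real ^ 'k ^ 'm"
  assumes "\<And>i k. k \<notin> S \<Longrightarrow> Z $ i $ k = 0"
  shows "rank Z \<le> card S"
proof -
  have "column k Z = 0" if "k \<notin> S" for k
    using assms[OF that] by (simp add: column_def vec_eq_iff)
  then have "columns Z \<subseteq> insert 0 ((\<lambda>k. column k Z) ` S)"
    by (auto simp: columns_def)
  then have "rank Z \<le> dim (insert 0 ((\<lambda>k. column k Z) ` S))"
    unfolding column_rank_def by (rule dim_subset)
  also have "\<dots> = dim ((\<lambda>k. column k Z) ` S)"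
    by (metis dim_span span_insert_0)
  also have "\<dots> \<le> card ((\<lambda>k. column k Z) ` S)"
    by (simp add: dim_le_card')
  also have "\<dots> \<le> card S"
    by (simp add: card_image_le)
  finally show ?thesis .
qed

text \<open>For orthonormal columns spanning the column space of \<open>M\<close>,
  \<open>W ** transpose W\<close> is the orthogonal projection onto that space, so it fixes each
  column of \<open>M\<close>.\<close>

lemma orthonormal_frame:
  fixes M :: "real ^ 'n ^ 'm" and S :: "'k::finite set"
  assumes "rank M \<le> card S"
  obtains W :: "real ^ 'k ^ 'm" where "W \<in> frame_box S" "W ** (transpose W ** M) = M"
proof -
  obtain B where B: "B \<subseteq> span (columns M)" "pairwise orthogonal B" "\<And>x. x \<in> B \<Longrightarrow> norm x = 1"
      "independent B" "card B = dim (span (columns M))" "span B = span (columns M)"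
    using orthonormal_basis_subspace[OF subspace_span, of "columns M"] by metis
  have finB: "finite B"
    using B(4) by (rule independent_imp_finite)
  have "card B \<le> card S"
    using assms B(5) by (simp add: column_rank_def)
  then obtain g where g: "g ` B \<subseteq> S" "inj_on g B"
    using card_le_inj[OF finB finite] by metis
  define W :: "real ^ 'k ^ 'm"
    where "W = (\<chi> i k. if k \<in> g ` B then inv_into B g k $ i else 0)"
  have "W \<in> frame_box S"
    unfolding mem_frame_box
  proof (intro allI)
    fix i k
    have "\<bar>inv_into B g k $ i\<bar> \<le> 1" if "k \<in> g ` B"
      using component_le_norm_cart[of "inv_into B g k" i] B(3)[OF inv_into_into[OF that]] by simp
    then show "if k \<in> S then \<bar>W $ i $ k\<bar> \<le> 1 else W $ i $ k = 0"
      using g(1) by (auto simp: W_def)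
  qed
  moreover have "W ** (transpose W ** M) = M"
  proof -
    have "(W ** (transpose W ** M)) $ i $ j = M $ i $ j" for i j
    proof -
      \<comment> \<open>Row \<open>k\<close> of \<open>transpose W ** M\<close> holds the
        coefficients of the columns of \<open>M\<close> along the basis vector placed at
        \<open>k\<close>.\<close>
      have *: "(transpose W ** M) $ k $ j = (if k \<in> g ` B then column j M \<bullet> inv_into B g k else 0)" for k
        by (auto simp: matrix_matrix_mult_def transpose_def W_def inner_vec_def column_def mult.commute)
      have "(W ** (transpose W ** M)) $ i $ j
          = (\<Sum>k\<in>UNIV. if k \<in> g ` B then (column j M \<bullet> inv_into B g k) * inv_into B g k $ i else 0)"
        unfolding matrix_matrix_mult_def[of W] vec_lambda_beta *
        by (rule sum.cong) (auto simp: W_def)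
      also have "\<dots> = (\<Sum>k\<in>g ` B. (column j M \<bullet> inv_into B g k) * inv_into B g k $ i)"
        by (simp add: sum.If_cases)
      also have "\<dots> = (\<Sum>b\<in>B. (column j M \<bullet> b) * b $ i)"
        by (simp add: sum.reindex[OF g(2)] inv_into_f_f[OF g(2)])
      also have "\<dots> = (\<Sum>b\<in>B. (column j M \<bullet> b) *\<^sub>R b) $ i"
        by simp
      \<comment> \<open>Fourier expansion of a vector in the span of an orthonormal set.\<close>
      also have "\<dots> = column j M $ i"
      proof -
        have "column j M \<in> span B"
          unfolding B(6) by (rule span_base) (auto simp: columns_def)
        then show ?thesis
          using orthonormal_basis_expand[OF B(2,3) _ finB] by metis
      qed
      finally show ?thesis
        by (simp add: column_def)
    qed
    then show ?thesis
      by (simp add: vec_eq_iff)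
  qed
  ultimately show ?thesis
    by (rule that)
qed

text \<open>The equation W W^T M = M cuts out a closed set of pairs (W, M), and projecting a closed
  set along a compact factor gives a closed set.\<close>

lemma closed_rank_le: "closed {M :: real ^ 'n ^ 'm. rank M \<le> r}"
\<comment> \<open>A set \<open>S\<close> of \<open>r\<close> indices exists only for
  \<open>r\<close> up to the number of rows; beyond that the rank condition always holds.\<close>
proof (cases "r \<le> CARD('m)")
  case True
  then obtain S :: "'m set" where S: "card S = r"
    by (metis obtain_subset_with_card_n)
  let ?T = "{p :: (real ^ 'm ^ 'm) \<times> (real ^ 'n ^ 'm). fst p ** (transpose (fst p) ** snd p) = snd p}"
  have "rank M \<le> r \<longleftrightarrow> (\<exists>W. W \<in> frame_box S \<and> (W, M) \<in> ?T)" for M :: "real ^ 'n ^ 'm"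
  proof
    assume "rank M \<le> r"
    then show "\<exists>W. W \<in> frame_box S \<and> (W, M) \<in> ?T"
      using orthonormal_frame[of M S] S by auto
  next
    assume "\<exists>W. W \<in> frame_box S \<and> (W, M) \<in> ?T"
    then obtain W where W: "W \<in> frame_box S" "W ** (transpose W ** M) = M"
      by auto
    \<comment> \<open>\<open>M\<close> factors through \<open>W\<close>, which has at most
      \<open>r\<close> nonzero columns.\<close>
    have "rank M \<le> rank W"
      by (metis W(2) rank_mul_le_left)
    also have "\<dots> \<le> r"
      using rank_le_card_columns[of S W] W(1) S by (auto simp: mem_frame_box)
    finally show "rank M \<le> r" .
  qed
  then have "{M. rank M \<le> r} = {M. \<exists>W. W \<in> frame_box S \<and> (W, M) \<in> ?T}"
    by blast
  moreover have "closed ?T"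
    by (intro closed_Collect_eq) 
      (auto simp: matrix_matrix_mult_def transpose_def intro!: continuous_intros)
  ultimately show ?thesis
    using closed_compact_projection[OF compact_frame_box[of S], of ?T] by (simp only:)
next
  case False
  then have "{M :: real ^ 'n ^ 'm. rank M \<le> r} = UNIV"
    using rank_bound[where 'm = 'm and 'n = 'n]
    by (metis (mono_tags, lifting) UNIV_eq_I mem_Collect_eq min.boundedE nat_le_linear order_trans)
  then show ?thesis
    by simp
qed

lemma symmetric_matrix_nth: "symmetric_matrix X \<Longrightarrow> X $ i $ j = X $ j $ i"
  by (simp add: symmetric_matrix_def transpose_def vec_eq_iff)

lemma pos_semidef_gram: "pos_semidef (Z ** transpose Z)"
proof -
  have "v \<bullet> ((Z ** transpose Z) *v v) = (transpose Z *v v) \<bullet> (transpose Z *v v)" for v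
    by (metis dot_lmul_matrix matrix_vector_mul_assoc transpose_matrix_vector)
  then show ?thesis
    by (simp add: pos_semidef_def symmetric_matrix_def matrix_transpose_mul)
qed

text \<open>The A-by-B block, padded with zeros to full size so that its type does not depend on the
  sets. Points of R^E are indexed by ordered pairs, hence \<open>min\<close> and \<open>max\<close>.
  The B-by-A block is left zero: keeping both could double the rank.\<close>

definition block :: "'n::{finite,linorder} set \<Rightarrow> 'n set \<Rightarrow> ('n \<times> 'n \<Rightarrow> real)
    \<Rightarrow> real ^ ('n::{finite,linorder}) ^ ('n::{finite,linorder})" where
  "block A B f = (\<chi> i j. if i \<in> A \<and> j \<in> B then f (min i j, max i j) else 0)"

text \<open>Each entry is a coordinate of R^E or the constant 0.\<close>

lemma continuous_map_block:
  fixes E :: "('n::{finite,linorder} \<times> 'n) set"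
  assumes "\<And>i j. i \<in> A \<Longrightarrow> j \<in> B \<Longrightarrow> (min i j, max i j) \<in> E"
  shows "continuous_map (powertop_real E) euclidean (block A B)"
  unfolding continuous_map_atin limitin_canonical_iff
proof
  fix f assume f: "f \<in> topspace (powertop_real E)"
  have "((\<lambda>g. g e) \<longlongrightarrow> f e) (atin (powertop_real E) f)" if "e \<in> E" for e
    using continuous_map_product_projection[OF that, of "\<lambda>_. euclidean :: real topology"] f
    unfolding continuous_map_atin limitin_canonical_iff by blast
  with assms show "(block A B \<longlongrightarrow> block A B f) (atin (powertop_real E) f)"
    unfolding block_def by (intro tendsto_vec_lambda) auto
qed

lemma rank_block_le:
  fixes X :: "real ^ ('n::{finite,linorder}) ^ ('n::{finite,linorder})"
  assumes "symmetric_matrix X" "\<And>i j. i \<in> A \<Longrightarrow> j \<in> B \<Longrightarrow> (min i j, max i j) \<in> E"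
  shows "rank (block A B (coord_proj E X)) \<le> rank X"
proof -
  \<comment> \<open>Diagonal 0/1 matrices: \<open>D A\<close> on the left keeps the rows in
    \<open>A\<close>, \<open>D B\<close> on the right the columns in \<open>B\<close>, and neither
    product raises the rank.\<close>
  define D where "D S = (\<chi> i j. if i = j \<and> i \<in> S then 1 else (0::real))" for S :: "'n set"
  note sym = symmetric_matrix_nth[OF assms(1)]
  have left: "(D S ** Y) $ i $ j = (if i \<in> S then Y $ i $ j else 0)" for S Y i j
  proof -
    have "(D S ** Y) $ i $ j = (\<Sum>k\<in>UNIV. if k = i then (if i \<in> S then Y $ i $ j else 0) else 0)"
      unfolding matrix_matrix_mult_def D_def vec_lambda_beta by (rule sum.cong) auto
    then show ?thesis by simp
  qed
  have right: "(Y ** D S) $ i $ j = (if j \<in> S then Y $ i $ j else 0)" for S Y i j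
  proof -
    have "(Y ** D S) $ i $ j = (\<Sum>k\<in>UNIV. if k = j then (if j \<in> S then Y $ i $ j else 0) else 0)"
      unfolding matrix_matrix_mult_def D_def vec_lambda_beta by (rule sum.cong) auto
    then show ?thesis by simp
  qed
  \<comment> \<open>For i > j the block reads the entry at (j, i), which symmetry of
    \<open>X\<close> identifies with the one at (i, j).\<close>
  have "block A B (coord_proj E X) $ i $ j = ((D A ** X) ** D B) $ i $ j" for i j
    using assms(2)[of i j] sym[of i j]
    by (cases "i \<le> j") (auto simp: left right block_def coord_proj_def min_def max_def)
  then have "block A B (coord_proj E X) = (D A ** X) ** D B"
    by (simp add: vec_eq_iff)
  then show ?thesis
    using rank_mul_le_left[of "D A ** X" "D B"] rank_mul_le_right[of "D A" X] by simp
qed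

lemma psd_completion:
  fixes M :: "real ^ 'n ^ 'n"
  assumes "rank M \<le> r" "r \<le> CARD('n)" "A \<inter> B = {}"
  obtains X where "X \<in> psd_rank_le r" "\<And>i j. i \<in> A \<Longrightarrow> j \<in> B \<Longrightarrow> X $ i $ j = M $ i $ j"
proof -
  obtain S :: "'n set" where S: "card S = r"
    using assms(2) by (metis obtain_subset_with_card_n)
  obtain W :: "real ^ 'n ^ 'n" where W: "W \<in> frame_box S" "W ** (transpose W ** M) = M"
    using orthonormal_frame[of M S] assms(1) S by auto
  \<comment> \<open>Rows in \<open>A\<close> come from W, all others from M^T W. The product of a
    row of the first kind with one of the second is an entry of W W^T M.\<close>
  define Z :: "real ^ 'n ^ 'n"
    where "Z = (\<chi> i k. if i \<in> A then W $ i $ k else (transpose W ** M) $ k $ i)"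
  have "rank (Z ** transpose Z) \<le> rank Z"
    by (rule rank_mul_le_left)
  \<comment> \<open>A zero column of W is also a zero column of M^T W, so \<open>Z\<close> has
    nonzero columns only in \<open>S\<close>.\<close>
  also have "rank Z \<le> r"
    unfolding S[symmetric]
    by (rule rank_le_card_columns)
      (use W(1) in \<open>auto simp: Z_def mem_frame_box matrix_matrix_mult_def transpose_def\<close>)
  finally have "Z ** transpose Z \<in> psd_rank_le r"
    by (simp add: psd_rank_le_def pos_semidef_gram)
  moreover have "(Z ** transpose Z) $ i $ j = M $ i $ j" if "i \<in> A" "j \<in> B" for i j
  proof -
    have "j \<notin> A"
      using that assms(3) by blast
    then have "(Z ** transpose Z) $ i $ j = (W ** (transpose W ** M)) $ i $ j"
      unfolding matrix_matrix_mult_def[of W] matrix_matrix_mult_def[of Z]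
      using that by (simp add: Z_def transpose_def[of "\<chi> i. _ i"])
    then show ?thesis
      by (simp add: W(2))
  qed
  ultimately show ?thesis
    by (rule that)
qed

text \<open>No edge lies inside \<open>A\<close> or inside \<open>B\<close>, so the diagonal blocks
  of a completion are free and only the rank of the off-diagonal block constrains
  \<open>f\<close>.\<close>

lemma coord_proj_psd_rank_le_bipartite:
  fixes E :: "('n::{finite,linorder} \<times> 'n) set"
  assumes E: "edge_set E" and disj: "A \<inter> B = {}"
    and adj: "\<And>i j. adjacent E i j \<longleftrightarrow> (i \<in> A \<and> j \<in> B) \<or> (i \<in> B \<and> j \<in> A)"
    and r: "r \<le> CARD('n)"
  shows "coord_proj E ` psd_rank_le r
    = {f \<in> topspace (powertop_real E). block A B f \<in> {M. rank M \<le> r}}"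
proof (intro equalityI subsetI)
  have edge: "(min i j, max i j) \<in> E" if "i \<in> A" "j \<in> B" for i j
    using adj[of i j] that E by (auto simp: adjacent_def edge_set_def min_def max_def)
  fix f assume "f \<in> coord_proj E ` psd_rank_le r"
  then obtain X where X: "pos_semidef X" "rank X \<le> r" and f: "f = coord_proj E X"
    by (auto simp: psd_rank_le_def)
  have "rank (block A B f) \<le> r"
    unfolding f using rank_block_le[of X A B E] X edge by (force simp: pos_semidef_def)
  moreover have "f \<in> topspace (powertop_real E)"
    by (simp add: f coord_proj_def)
  ultimately show "f \<in> {f \<in> topspace (powertop_real E). block A B f \<in> {M. rank M \<le> r}}"
    by simp
next
  fix f assume "f \<in> {f \<in> topspace (powertop_real E). block A B f \<in> {M. rank M \<le> r}}"
  then have f: "f \<in> extensional E" "rank (block A B f) \<le> r"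
    by (auto simp: PiE_def)
  obtain X where X: "X \<in> psd_rank_le r"
      "\<And>i j. i \<in> A \<Longrightarrow> j \<in> B \<Longrightarrow> X $ i $ j = block A B f $ i $ j"
    using psd_completion[OF f(2) r disj] by blast
  have sym: "X $ i $ j = X $ j $ i" for i j
    using X(1) by (intro symmetric_matrix_nth) (simp add: psd_rank_le_def pos_semidef_def)
  \<comment> \<open>An edge with i \<le> j may run from \<open>B\<close> to \<open>A\<close>;
    symmetry of \<open>X\<close> then moves it into the A-by-B block.\<close>
  have "X $ i $ j = f (i, j)" if ij: "(i, j) \<in> E" for i j
  proof -
    have "i \<le> j"
      using E ij by (auto simp: edge_set_def)
    moreover have "(i \<in> A \<and> j \<in> B) \<or> (i \<in> B \<and> j \<in> A)"
      using adj ij by (auto simp: adjacent_def)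
    ultimately show ?thesis
      using X(2)[of i j] X(2)[of j i] sym[of i j]
      by (auto simp: block_def min_absorb1 max_absorb2 min_absorb2 max_absorb1)
  qed
  then have "coord_proj E X = f"
    using f(1) by (auto simp: coord_proj_def fun_eq_iff extensional_def)
  then show "f \<in> coord_proj E ` psd_rank_le r"
    using X(1) by blast
qed

theorem theorem3p1:
  fixes E :: "('n::{finite,linorder} \<times> 'n) set"
  assumes "CARD('n) \<ge> 2"
    and "edge_set E"
    and "loopless E"
    and "complete_bipartite E"
  shows "\<forall>r::nat. 0 \<le> r \<and> r \<le> CARD('n) \<longrightarrow>
           closedin (powertop_real E) (coord_proj E ` psd_rank_le r)"
proof (intro allI impI, elim conjE)
  fix r :: nat
  assume r: "r \<le> CARD('n)"
  obtain A B where disj: "A \<inter> B = {}"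
    and adj: "\<And>i j. adjacent E i j \<longleftrightarrow> (i \<in> A \<and> j \<in> B) \<or> (i \<in> B \<and> j \<in> A)"
    using assms(4) unfolding complete_bipartite_def by metis
  have edge: "(min i j, max i j) \<in> E" if "i \<in> A" "j \<in> B" for i j
    using adj[of i j] that assms(2) by (auto simp: adjacent_def edge_set_def min_def max_def)
  show "closedin (powertop_real E) (coord_proj E ` psd_rank_le r)"
    \<comment> \<open>The image is now a preimage of the closed set of matrices of rank at most
      \<open>r\<close> under the continuous map \<open>block A B\<close>.\<close>
    unfolding coord_proj_psd_rank_le_bipartite[OF assms(2) disj adj r]
    by (intro closedin_continuous_map_preimage[OF continuous_map_block[OF edge]])
      (simp_all add: closed_rank_le flip: closed_closedin)
qed

end
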